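(* For $0\le p\le 1/\sqrt2$, the greedy-based edge-arrival algorithm with sample $E'=H$ is $c(p)$-competitive in the $\mathrm{AOS}p$ model for online weighted matching with edge arrivals in general graphs, where $$c(p)=\begin{cases} p^2/2 & p\le 1/3,\\ p(1-p)/4 & 1/3<p\le1/2,\\ p^2(1-p)/2 & 1/2<p\le(\sqrt5-1)/2,\\ (1-p)(2p-1)/(2p) & (\sqrt5-1)/2<p\le1/\sqrt2.\end{cases}$$
   Context: $\mathrm{AOS}p$ model (adversarial order with $p$-sampling) for matching with edge arrivals: (1) The adversary generates a finite graph $G=(V,E)$ with weights $w:E\to\mathbb{R}_{\ge0}$ (ties broken by a fixed consistent rule, so edge weights are totally ordered). (2) Each $e\in E$ is put in the history set $H$ independently with probability $p$; $p$ and the edges of $H$ with their weights are given to the online player upfront. The online set is $O=E\setminus H$. (3) The edges of $O$ arrive one by one in an adversarial order (which may depend on $H$); when an edge arrives its weight is revealed, and the player must immediately and irrevocably accept it (keeping accepted edges vertex-disjoint) or reject it. For $F\subseteq E$, $G[F]$ is the subgraph with edge set $F$. $\mathrm{OPT}$ is the (random) maximum weight of a matching in $G[O]$. An algorithm is $c$-competitive if $\mathrm{E}[\mathrm{ALG}]\ge c\cdot\mathrm{E}[\mathrm{OPT}]$ on every instance $(G,p)$, where $\mathrm{ALG}$ is the weight of its output matching and expectations are over $H$ and the algorithm's internal randomness. $\mathrm{Greedy}(K)$: process the edges of $K$ in non-increasing order of weight, adding an edge to the matching iff neither endpoint is already covered. Greedy-based edge-arrival algorithm with sample $E'$: set $M=\emptyset$.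 When an edge $e=(u,v)\in O$ arrives, if $e\in\mathrm{Greedy}(G[E'\cup\{e\}])$ and neither $u$ nor $v$ is matched in $M$, add $e$ to $M$. Output $M$. *)

theory Defs
  imports "HOL-Probability.Probability"
begin

type_synonym 'v edge = "'v set"

text \<open>
  Finite simple graphs with nonnegative edge weights. The list rk enumerates the edges by
  non-increasing weight; among edges of equal weight, its order is the fixed tie-breaking rule, so
  a position in rk is a place in the resulting total order of the edges.
\<close>

locale weighted_graph =
  fixes V :: "'v set" and E :: "'v edge set" and w :: "'v edge \<Rightarrow> real" and rk :: "'v edge list"
  assumes finite_vertices: "finite V"
    and edges: "\<And>e. e \<in> E \<Longrightarrow> e \<subseteq> V \<and> card e = 2"
    and weight_nonneg: "\<And>e. e \<in> E \<Longrightarrow> w e \<ge> 0"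
    and ranking: "distinct rk" "set rk = E" "sorted_wrt (\<lambda>e f. w e \<ge> w f) rk"

definition matching :: "'v edge set \<Rightarrow> bool" where
  "matching M \<longleftrightarrow> pairwise disjnt M"

definition max_weight :: "('v edge \<Rightarrow> real) \<Rightarrow> 'v edge set \<Rightarrow> real" where
  "max_weight w F = Max {sum w M | M. M \<subseteq> F \<and> matching M}"

definition add_if_free :: "'v edge \<Rightarrow> 'v edge set \<Rightarrow> 'v edge set" where
  "add_if_free e M = (if e \<inter> \<Union>M = {} then insert e M else M)"

definition greedy :: "'v edge list \<Rightarrow> 'v edge set \<Rightarrow> 'v edge set" where
  "greedy rk K = fold add_if_free (filter (\<lambda>e. e \<in> K) rk) {}"

text \<open>
  In the arrival list the edge that arrives first is at the head. The decision about an edge uses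
  the ranking only on the sample and that edge.
\<close>

definition greedy_based :: "'v edge list \<Rightarrow> 'v edge set \<Rightarrow> 'v edge list \<Rightarrow> 'v edge set" where
  "greedy_based rk S arrivals =
     fold (\<lambda>e M. if e \<in> greedy rk (insert e S) then add_if_free e M else M) arrivals {}"

definition history_pmf :: "real \<Rightarrow> 'v edge set \<Rightarrow> 'v edge set pmf" where
  "history_pmf p E =
     map_pmf (\<lambda>b. {e \<in> E. b e}) (Pi_pmf E False (\<lambda>_. bernoulli_pmf p))"

text \<open>
  A deterministic algorithm is represented by its output matching, as a function of the weights,
  the ranking, the history set and the list of arrivals. There is no internal randomness, so
  expectations are over the history set only. The adversary is a map from history sets to arrival
  orders; against a deterministic algorithm this covers adaptive adversaries as well.
\<close>

type_synonym 'v algorithm =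
  "('v edge \<Rightarrow> real) \<Rightarrow> 'v edge list \<Rightarrow> 'v edge set \<Rightarrow> 'v edge list \<Rightarrow> 'v edge set"

definition arrival_strategy :: "'v edge set \<Rightarrow> ('v edge set \<Rightarrow> 'v edge list) \<Rightarrow> bool" where
  "arrival_strategy E arr \<longleftrightarrow> (\<forall>H \<subseteq> E. distinct (arr H) \<and> set (arr H) = E - H)"

definition competitive_AOSp :: "real \<Rightarrow> real \<Rightarrow> 'v algorithm \<Rightarrow> bool" where
  "competitive_AOSp p c A \<longleftrightarrow>
     (\<forall>V E w rk arr. weighted_graph V E w rk \<longrightarrow> arrival_strategy E arr \<longrightarrow>
        measure_pmf.expectation (history_pmf p E) (\<lambda>H. sum w (A w rk H (arr H)))
          \<ge> c * measure_pmf.expectation (history_pmf p E) (\<lambda>H. max_weight w (E - H)))"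

definition ratio :: "real \<Rightarrow> real" where
  "ratio p =
     (if p \<le> 1/3 then p^2 / 2
      else if p \<le> 1/2 then p * (1 - p) / 4
      else if p \<le> (sqrt 5 - 1) / 2 then p^2 * (1 - p) / 2
      else (1 - p) * (2 * p - 1) / (2 * p))"

end

theory Submission
  imports Defs
begin

text \<open>
  Call an online edge a candidate if it belongs to the greedy matching of the history set together
  with that edge; the algorithm outputs a maximal matching M of the set C of candidates. Going
  through the edges by non-increasing weight, an edge whose ends are both uncovered by the greedy
  matching of the history set enters that matching with probability p and C with probability 1 - p.
  Hence p E[w(C)] = (1 - p) E[w(Greedy(H))].

  To compare Greedy(H) with OPT, let F contain each edge independently with probability 1 - p, so that
  F is distributed like the online set, and couple H with F such that each edge of F lies in H with
  conditional probability r = min(1/2, p/(1 - p)). Either an edge e of the optimal matching of F is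
  blocked, and then the greedy matching has at least the weight w(e) at one end of e, or it enters
  with probability r and counts at both ends. So E[w(Greedy(H))] is at least r E[OPT].

  To compare M with C, let L consist of the candidates that meet no later candidate. A candidate
  lies in L with probability at least p^2, since the next free edge at each end lies in H with
  probability p. An edge of L outside M meets an earlier edge of M, so it is not the first candidate
  at both ends, and charging to the ends of the edges of M gives
  2 w(M) >= (sum over e in L of max(1, number of ends at which e is first) w(e)). The ends at which
  a candidate is first make up, in weighted expectation, a fraction p of all ends of candidates; this
  yields the factors p^2/2 and p^3. The factor 2p - 1 comes from w(M) + w(C) >= (sum over e in C of
  the number of ends at which e is last, times w(e)).
\<close>

section \<open>Expectations over independent coins\<close>

text \<open>This is the expectation of \<open>f\<close> over a random subset that contains each
  \<open>x\<close> of the list independently with probability \<open>q x\<close>. The recursion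
  reveals one coin at a time, which suits inductions along the ranking; the coupling with the online
  set needs biases that vary with the element.\<close>

primrec coin_avg :: "('a \<Rightarrow> real) \<Rightarrow> 'a list \<Rightarrow> ('a set \<Rightarrow> real) \<Rightarrow> real" where
  "coin_avg q [] f = f {}"
| "coin_avg q (x # xs) f =
     q x * coin_avg q xs (\<lambda>H. f (insert x H)) + (1 - q x) * coin_avg q xs f"

lemma coin_avg_cong:
  assumes "\<And>x. x \<in> set xs \<Longrightarrow> q x = q' x" "\<And>H. H \<subseteq> set xs \<Longrightarrow> f H = g H"
  shows "coin_avg q xs f = coin_avg q' xs g"
  using assms
proof (induction xs arbitrary: f g)
  case (Cons x xs)
  have "coin_avg q xs (\<lambda>H. f (insert x H)) = coin_avg q' xs (\<lambda>H. g (insert x H))"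
    by (rule Cons.IH) (auto intro!: Cons.prems)
  moreover have "coin_avg q xs f = coin_avg q' xs g"
    by (rule Cons.IH) (auto intro!: Cons.prems)
  ultimately show ?case using Cons.prems(1)[of x] by simp
qed simp

lemma coin_avg_mono:
  assumes "\<And>x. x \<in> set xs \<Longrightarrow> 0 \<le> q x \<and> q x \<le> 1" "\<And>H. H \<subseteq> set xs \<Longrightarrow> f H \<le> g H"
  shows "coin_avg q xs f \<le> coin_avg q xs g"
  using assms
proof (induction xs arbitrary: f g)
  case (Cons x xs)
  have "coin_avg q xs (\<lambda>H. f (insert x H)) \<le> coin_avg q xs (\<lambda>H. g (insert x H))"
    by (rule Cons.IH) (auto intro!: Cons.prems)
  moreover have "coin_avg q xs f \<le> coin_avg q xs g"
    by (rule Cons.IH) (auto intro!: Cons.prems)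
  ultimately show ?case using Cons.prems(1)[of x] by (auto intro!: add_mono mult_left_mono)
qed simp

lemma coin_avg_const [simp]: "coin_avg q xs (\<lambda>_. c) = c"
  by (induction xs) (auto simp: algebra_simps)

lemma coin_avg_add: "coin_avg q xs (\<lambda>H. f H + g H) = coin_avg q xs f + coin_avg q xs g"
  by (induction xs arbitrary: f g) (simp_all add: algebra_simps)

lemma coin_avg_cmult: "coin_avg q xs (\<lambda>H. c * f H) = c * coin_avg q xs f"
  by (induction xs arbitrary: f) (simp_all add: algebra_simps)

lemma coin_avg_sum: "coin_avg q xs (\<lambda>H. \<Sum>i\<in>A. f i H) = (\<Sum>i\<in>A. coin_avg q xs (f i))"
  by (induction A rule: infinite_finite_induct) (simp_all add: coin_avg_add)

lemma coin_avg_complement: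
  assumes "distinct xs"
  shows "coin_avg q xs (\<lambda>H. f (set xs - H)) = coin_avg (\<lambda>x. 1 - q x) xs f"
  using assms
proof (induction xs arbitrary: f)
  case (Cons x xs)
  have "coin_avg q xs (\<lambda>H. f (set (x # xs) - insert x H)) = coin_avg q xs (\<lambda>H. f (set xs - H))"
    using Cons.prems by (intro coin_avg_cong refl arg_cong[where f = f]) auto
  moreover have "coin_avg q xs (\<lambda>H. f (set (x # xs) - H)) =
      coin_avg q xs (\<lambda>H. f (insert x (set xs - H)))"
    using Cons.prems by (intro coin_avg_cong refl arg_cong[where f = f]) auto
  ultimately show ?case
    using Cons.prems Cons.IH[of f] Cons.IH[of "\<lambda>H. f (insert x H)"] by simp
qed simp

text \<open>By total probability an element enters \<open>H\<close> with chance
  \<open>(1 - p) * r + p * s = p\<close>, independently of the others. So \<open>H\<close> has the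
  law of the history set and \<open>F\<close> that of the online set, although the two need not be
  complementary.\<close>

lemma coin_avg_two_stage:
  assumes "distinct xs" "(1 - p) * r + p * s = p"
  shows "coin_avg (\<lambda>_. 1 - p) xs (\<lambda>F. coin_avg (\<lambda>x. if x \<in> F then r else s) xs f) =
    coin_avg (\<lambda>_. p) xs f"
  using assms(1)
proof (induction xs arbitrary: f)
  case (Cons x xs)
  let ?q = "\<lambda>F x. if x \<in> F then r else s"
  let ?D = "coin_avg (\<lambda>_. 1 - p) xs"
  have 1: "?D (\<lambda>F. coin_avg (?q (insert x F)) (x # xs) f) =
      ?D (\<lambda>F. r * coin_avg (?q F) xs (\<lambda>H. f (insert x H)) + (1 - r) * coin_avg (?q F) xs f)"
  proof (rule coin_avg_cong[OF refl])
    fix F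
    have "coin_avg (?q (insert x F)) xs g = coin_avg (?q F) xs g" for g
      using Cons.prems by (intro coin_avg_cong) auto
    then show "coin_avg (?q (insert x F)) (x # xs) f =
        r * coin_avg (?q F) xs (\<lambda>H. f (insert x H)) + (1 - r) * coin_avg (?q F) xs f"
      by simp
  qed
  have 2: "?D (\<lambda>F. coin_avg (?q F) (x # xs) f) =
      ?D (\<lambda>F. s * coin_avg (?q F) xs (\<lambda>H. f (insert x H)) + (1 - s) * coin_avg (?q F) xs f)"
    using Cons.prems by (intro coin_avg_cong) auto
  define a b where "a = coin_avg (\<lambda>_. p) xs (\<lambda>H. f (insert x H))"
    and "b = coin_avg (\<lambda>_. p) xs f"
  have "coin_avg (\<lambda>_. 1 - p) (x # xs) (\<lambda>F. coin_avg (?q F) (x # xs) f) =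
      (1 - p) * (r * a + (1 - r) * b) + p * (s * a + (1 - s) * b)"
    using Cons.prems Cons.IH[of f] Cons.IH[of "\<lambda>H. f (insert x H)"]
    unfolding coin_avg.simps(2)[of "\<lambda>_. 1 - p"] 1 2 a_def b_def
    by (simp add: coin_avg_add coin_avg_cmult)
  also have "\<dots> = ((1 - p) * r + p * s) * a + (1 - ((1 - p) * r + p * s)) * b"
    by (simp add: algebra_simps)
  finally show ?case by (simp add: assms(2) a_def b_def)
qed simp

lemma expectation_history_pmf:
  assumes "distinct xs" "0 \<le> p" "p \<le> 1"
  shows "measure_pmf.expectation (history_pmf p (set xs)) f = coin_avg (\<lambda>_. p) xs f"
  using assms(1)
proof (induction xs arbitrary: f)
  case Nil
  show ?case by (simp add: history_pmf_def)
next
  case (Cons x xs)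
  let ?P = "Pi_pmf (set xs) False (\<lambda>_. bernoulli_pmf p)"
  have supp: "b y \<Longrightarrow> y \<in> set xs" if "b \<in> set_pmf ?P" for b y
    using set_Pi_pmf_subset[of "set xs" False "\<lambda>_. bernoulli_pmf p"] that by auto
  have "history_pmf p (set (x # xs)) =
      bernoulli_pmf p \<bind> (\<lambda>c. map_pmf (\<lambda>H. if c then insert x H else H) (history_pmf p (set xs)))"
  proof -
    have *: "map_pmf (\<lambda>b. {e \<in> insert x (set xs). (b(x := c)) e}) ?P =
        map_pmf (\<lambda>b. if c then insert x {e \<in> set xs. b e} else {e \<in> set xs. b e}) ?P" for c
      using Cons.prems by (intro map_pmf_cong refl) (auto dest: supp)
    have "history_pmf p (set (x # xs)) = bernoulli_pmf p \<bind>
        (\<lambda>c. map_pmf (\<lambda>b. {e \<in> insert x (set xs). (b(x := c)) e}) ?P)"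
      using Cons.prems
      by (simp add: history_pmf_def Pi_pmf_insert' map_bind_pmf map_pmf_def[symmetric] pmf.map_comp o_def)
    then show ?thesis
      unfolding * by (simp add: history_pmf_def pmf.map_comp o_def)
  qed
  moreover have "finite (set_pmf (history_pmf p (set xs)))"
    by (rule finite_subset[of _ "Pow (set xs)"]) (auto simp: history_pmf_def)
  ultimately show ?case
    using Cons.prems Cons.IH assms(2,3)
    by (subst \<open>history_pmf p (set (x # xs)) = _\<close>, subst pmf_expectation_bind[where A = UNIV])
      (auto simp: UNIV_bool)
qed

section \<open>Candidates and the greedy matching of the history set\<close>

text \<open>One pass runs greedy on \<open>H\<close> with current matching \<open>G\<close>. A free
  edge outside \<open>H\<close> is listed without changing \<open>G\<close>, because an online edge
  is tested against the sample alone. A general start \<open>G\<close> is what the inductions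
  need.\<close>

primrec candidates :: "'v edge list \<Rightarrow> 'v edge set \<Rightarrow> 'v edge set \<Rightarrow> 'v edge list" where
  "candidates [] H G = []"
| "candidates (e # es) H G =
     (if e \<inter> \<Union>G \<noteq> {} then candidates es H G
      else if e \<in> H then candidates es H (insert e G)
      else e # candidates es H G)"

abbreviation greedy_from :: "'v edge list \<Rightarrow> 'v edge set \<Rightarrow> 'v edge set \<Rightarrow> 'v edge set" where
  "greedy_from es H G \<equiv> fold add_if_free (filter (\<lambda>e. e \<in> H) es) G"

lemma candidates_cong:
  "H \<inter> set es = H' \<inter> set es \<Longrightarrow> candidates es H G = candidates es H' G"
proof (induction es arbitrary: G)
  case (Cons e es)
  have "H \<inter> set es = H' \<inter> set es" "e \<in> H \<longleftrightarrow> e \<in> H'" using Cons.prems by auto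
  then show ?case using Cons.IH by simp
qed simp

lemma set_candidates_subset: "set (candidates es H G) \<subseteq> set es"
  by (induction es arbitrary: G) auto

lemma distinct_candidates: "distinct es \<Longrightarrow> distinct (candidates es H G)"
  using set_candidates_subset by (induction es arbitrary: G) fastforce+

lemma sorted_candidates: "sorted_wrt R es \<Longrightarrow> sorted_wrt R (candidates es H G)"
  using set_candidates_subset by (induction es arbitrary: G) fastforce+

lemma greedy_from_mono: "G \<subseteq> greedy_from es H G"
proof (induction es arbitrary: G)
  case (Cons e es)
  show ?case using Cons.IH[of G] Cons.IH[of "add_if_free e G"] by (auto simp: add_if_free_def)
qed simp

lemma greedy_from_subset: "greedy_from es H G \<subseteq> G \<union> set es"
proof (induction es arbitrary: G)
  case (Cons e es)
  show ?case using Cons.IH[of G] Cons.IH[of "add_if_free e G"]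
    by (auto simp: add_if_free_def split: if_splits)
qed simp

lemma finite_greedy_from: "finite G \<Longrightarrow> finite (greedy_from es H G)"
  by (rule finite_subset[OF greedy_from_subset]) simp

lemma disjnt_add_if_free: "pairwise disjnt M \<Longrightarrow> pairwise disjnt (add_if_free e M)"
  by (auto simp: add_if_free_def pairwise_insert disjnt_def)

text \<open>Until the turn of \<open>e\<close>, greedy behaves the same with and without
  \<open>e\<close> in the sample. It then takes \<open>e\<close> exactly if \<open>e\<close> is
  free, and edges once taken stay.\<close>

lemma in_candidates_iff:
  assumes "distinct es" "set es \<inter> G = {}" "{} \<notin> set es"
  shows "e \<in> set (candidates es H G) \<longleftrightarrow> e \<in> set es - H \<and> e \<in> greedy_from es (insert e H) G"
  using assms
proof (induction es arbitrary: G)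
  case (Cons x xs)
  have IH: "e \<in> set (candidates xs H G') \<longleftrightarrow>
      e \<in> set xs - H \<and> e \<in> greedy_from xs (insert e H) G'" if "set xs \<inter> G' = {}" for G'
    using Cons that by auto
  have G: "set xs \<inter> G = {}" "set xs \<inter> insert x G = {}" using Cons.prems by auto
  show ?case
  proof (cases "x = e")
    case True
    have "e \<notin> set (candidates xs H G')" for G'
      using set_candidates_subset[of xs H] Cons.prems True by auto
    moreover have "e \<in> greedy_from xs (insert e H) (insert e G)"
      using greedy_from_mono by fast
    moreover have "e \<notin> greedy_from xs (insert e H) G"
      using greedy_from_subset[of "insert e H" xs G] Cons.prems True by auto
    ultimately show ?thesis using True by (auto simp: add_if_free_def[of e])
  next
    case False
    then show ?thesis using IH[OF G(1)] IH[OF G(2)] by (auto simp: add_if_free_def[of x])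
  qed
qed simp

section \<open>Averages along the candidate list\<close>

lemma coin_avg_candidates_blocked:
  assumes "e \<notin> set es" "e \<inter> \<Union>G \<noteq> {}"
  shows "coin_avg q (e # es) (\<lambda>H. F (candidates (e # es) H G)) =
    coin_avg q es (\<lambda>H. F (candidates es H G))"
proof -
  have "coin_avg q es (\<lambda>H. F (candidates es (insert e H) G)) =
      coin_avg q es (\<lambda>H. F (candidates es H G))"
    using assms by (intro coin_avg_cong refl arg_cong[where f = F] candidates_cong) auto
  then show ?thesis using assms by (simp add: algebra_simps)
qed

text \<open>Only the coins of free edges matter: one outcome adds the edge to \<open>G\<close>, the
  other lists it. As \<open>F\<close> is an arbitrary function of the list, this expansion serves as
  the induction step of the estimates on candidates.\<close>

lemma coin_avg_candidates_free:
  assumes "e \<notin> set es" "e \<inter> \<Union>G = {}"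
  shows "coin_avg q (e # es) (\<lambda>H. F (candidates (e # es) H G)) =
    q e * coin_avg q es (\<lambda>H. F (candidates es H (insert e G))) +
    (1 - q e) * coin_avg q es (\<lambda>H. F (e # candidates es H G))"
proof -
  have "coin_avg q es (\<lambda>H. F (candidates es (insert e H) (insert e G))) =
      coin_avg q es (\<lambda>H. F (candidates es H (insert e G)))"
    using assms by (intro coin_avg_cong refl arg_cong[where f = F] candidates_cong) auto
  moreover have "coin_avg q es (\<lambda>H. F (candidates (e # es) H G)) =
      coin_avg q es (\<lambda>H. F (e # candidates es H G))"
    using assms by (intro coin_avg_cong refl arg_cong[where f = F]) auto
  ultimately show ?thesis using assms by simp
qed

text \<open>With probability \<open>p\<close> the next free edge meeting \<open>T\<close> enters the
  greedy matching and covers a further vertex of \<open>T\<close>. After at most one such success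
  per uncovered vertex of \<open>T\<close>, every edge meeting \<open>T\<close> is blocked.\<close>

lemma coin_avg_no_later_candidate:
  assumes "distinct es" "finite T" "0 \<le> p" "p \<le> 1"
  shows "p ^ card (T - \<Union>G) \<le>
    coin_avg (\<lambda>_. p) es (\<lambda>H. if T \<inter> \<Union>(set (candidates es H G)) = {} then 1 else 0)"
  using assms(1)
proof (induction es arbitrary: G)
  case Nil
  show ?case using assms by (simp add: power_le_one)
next
  case (Cons e es)
  let ?F = "\<lambda>cs. if T \<inter> \<Union>(set cs) = {} then 1 else 0 :: real"
  let ?n = "\<lambda>G. card (T - \<Union>G)"
  have IH: "p ^ ?n G \<le> coin_avg (\<lambda>_. p) es (\<lambda>H. ?F (candidates es H G))" for G
    using Cons by simp
  have e: "e \<notin> set es" using Cons.prems by simp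
  show ?case
  proof (cases "e \<inter> \<Union>G = {}")
    case free: True
    show ?thesis
    proof (cases "T \<inter> e = {}")
      case True
      then have "?n (insert e G) = ?n G" by (auto intro!: arg_cong[where f = card])
      then have "p ^ ?n G = p * p ^ ?n (insert e G) + (1 - p) * p ^ ?n G"
        by (simp add: algebra_simps)
      also have "\<dots> \<le> p * coin_avg (\<lambda>_. p) es (\<lambda>H. ?F (candidates es H (insert e G))) +
          (1 - p) * coin_avg (\<lambda>_. p) es (\<lambda>H. ?F (candidates es H G))"
        using assms by (intro add_mono mult_left_mono IH) auto
      also have "\<dots> = coin_avg (\<lambda>_. p) (e # es) (\<lambda>H. ?F (candidates (e # es) H G))"
        using True by (subst coin_avg_candidates_free[OF e free, of _ ?F]) (simp add: Int_Un_distrib)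
      finally show ?thesis .
    next
      case False
      then have "?n (insert e G) < ?n G"
        using assms(2) free by (intro psubset_card_mono) auto
      \<comment> \<open>The edge may cover several vertices of \<open>T\<close> at once; since
        \<open>p\<close> is at most 1, the bound then only improves.\<close>
      then have "p ^ ?n G \<le> p ^ Suc (?n (insert e G))"
        using assms by (intro power_decreasing) auto
      also have "\<dots> \<le> p * coin_avg (\<lambda>_. p) es (\<lambda>H. ?F (candidates es H (insert e G)))"
        using mult_left_mono[OF IH[of "insert e G"] assms(3)] by simp
      also have "\<dots> = coin_avg (\<lambda>_. p) (e # es) (\<lambda>H. ?F (candidates (e # es) H G))"
        using False
        by (subst coin_avg_candidates_free[OF e free, of _ ?F]) (simp add: Int_Un_distrib)
      finally show ?thesis .
    qed
  next
    case False
    show ?thesis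
      using IH[of G] by (subst coin_avg_candidates_blocked[OF e False, of _ ?F])
  qed
qed

text \<open>
  The arguments of s are the union of the earlier edges of the list, the edge itself, and the
  union of the later edges.
\<close>

primrec score ::
  "('v set \<Rightarrow> 'v edge \<Rightarrow> 'v set \<Rightarrow> real) \<Rightarrow> ('v edge \<Rightarrow> real) \<Rightarrow> 'v set \<Rightarrow> 'v edge list \<Rightarrow> real" where
  "score s w U [] = 0"
| "score s w U (e # cs) = s U e (\<Union>(set cs)) * w e + score s w (U \<union> e) cs"

lemma score_cmult: "score (\<lambda>U e X. c * s U e X) w U cs = c * score s w U cs"
  by (induction cs arbitrary: U) (simp_all add: algebra_simps)

lemma score_mono:
  assumes "\<And>U e X. e \<in> set cs \<Longrightarrow> s U e X \<le> t U e X" "\<And>e. e \<in> set cs \<Longrightarrow> 0 \<le> w e"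
  shows "score s w U cs \<le> score t w U cs"
  using assms by (induction cs arbitrary: U) (auto intro!: add_mono mult_right_mono)

lemma score_one: "distinct cs \<Longrightarrow> score (\<lambda>_ _ _. 1) w U cs = sum w (set cs)"
  by (induction cs arbitrary: U) simp_all

text \<open>When \<open>e\<close> becomes a candidate, \<open>U\<close> is settled and the coins of
  the later edges are still fresh. So a lower bound \<open>t U e\<close> on the mean of
  \<open>s\<close> over these coins may replace \<open>s\<close> term by term.\<close>

lemma coin_avg_score_mono:
  assumes "distinct es" "0 \<le> p" "p \<le> 1" "\<And>e. e \<in> set es \<Longrightarrow> 0 \<le> w e"
    and later: "\<And>es' e G U. distinct es' \<Longrightarrow> e \<in> set es \<Longrightarrow> e \<inter> \<Union>G = {} \<Longrightarrow>
      t U e \<le> coin_avg (\<lambda>_. p) es' (\<lambda>H. s U e (\<Union>(set (candidates es' H G))))"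
  shows "coin_avg (\<lambda>_. p) es (\<lambda>H. score (\<lambda>U e _. t U e) w U (candidates es H G)) \<le>
    coin_avg (\<lambda>_. p) es (\<lambda>H. score s w U (candidates es H G))"
  using assms(1,4) later
proof (induction es arbitrary: G U)
  case (Cons e es)
  let ?t = "\<lambda>U e _. t U e"
  have IH: "coin_avg (\<lambda>_. p) es (\<lambda>H. score ?t w U (candidates es H G)) \<le>
      coin_avg (\<lambda>_. p) es (\<lambda>H. score s w U (candidates es H G))" for G U
    using Cons.prems by (intro Cons.IH) auto
  have e: "e \<notin> set es" using Cons.prems by simp
  show ?case
  proof (cases "e \<inter> \<Union>G = {}")
    case True
    have "t U e * w e \<le>
        coin_avg (\<lambda>_. p) es (\<lambda>H. s U e (\<Union>(set (candidates es H G)))) * w e"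
      using Cons.prems True by (intro mult_right_mono) auto
    also have "\<dots> = coin_avg (\<lambda>_. p) es (\<lambda>H. s U e (\<Union>(set (candidates es H G))) * w e)"
      by (simp add: coin_avg_cmult[symmetric] mult.commute)
    finally have "coin_avg (\<lambda>_. p) es (\<lambda>H. score ?t w U (e # candidates es H G)) \<le>
        coin_avg (\<lambda>_. p) es (\<lambda>H. score s w U (e # candidates es H G))"
      using IH[of "U \<union> e" G] by (simp add: coin_avg_add)
    then show ?thesis
      using assms(2,3) IH[of U "insert e G"]
      by (subst (1 2) coin_avg_candidates_free[OF e True]) (auto intro!: add_mono mult_left_mono)
  next
    case False
    then show ?thesis
      using IH by (subst (1 2) coin_avg_candidates_blocked[OF e False])
  qed
qed simp

text \<open>
  The last summand is a potential. An uncovered vertex that has already met a candidate still lies on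
  at most (1 - p) / p further candidates in expectation, each of weight at most B; all terms are
  scaled by p.
\<close>

lemma coin_avg_first_ends:
  assumes "distinct es" "\<And>e. e \<in> set es \<Longrightarrow> card e = 2 \<and> 0 \<le> w e \<and> w e \<le> B"
    "sorted_wrt (\<lambda>e f. w e \<ge> w f) es" "finite U" "0 \<le> B" "0 \<le> p" "p \<le> 1"
  shows "coin_avg (\<lambda>_. p) es (\<lambda>H. score (\<lambda>_ _ _. 2 * p) w U (candidates es H G)) \<le>
    coin_avg (\<lambda>_. p) es (\<lambda>H. score (\<lambda>U e _. card (e - U)) w U (candidates es H G)) +
    (1 - p) * B * card (U - \<Union>G)"
  using assms(1-5)
proof (induction es arbitrary: G U B)
  case Nil
  then show ?case using assms(7) by simp
next
  case (Cons e es)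
  let ?A = "\<lambda>U G. coin_avg (\<lambda>_. p) es (\<lambda>H. score (\<lambda>_ _ _. 2 * p) w U (candidates es H G))"
  let ?B = "\<lambda>U G. coin_avg (\<lambda>_. p) es
    (\<lambda>H. score (\<lambda>U e _. card (e - U)) w U (candidates es H G))"
  let ?d = "\<lambda>U G. real (card (U - \<Union>G))"
  have e: "e \<notin> set es" "card e = 2" "0 \<le> w e" "w e \<le> B" using Cons.prems by auto
  have "finite e" using e(2) by (metis card.infinite zero_neq_numeral)
  \<comment> \<open>By the order of the edges, \<open>w e\<close> serves as the new bound on all
    later weights.\<close>
  have IH: "?A U G \<le> ?B U G + (1 - p) * w e * ?d U G" if "finite U" for U G
    using Cons.prems that by (intro Cons.IH) auto
  show ?case
  proof (cases "e \<inter> \<Union>G = {}")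
    case True
    define i j where "i = real (card (e - U))" and "j = real (card (e \<inter> U))"
    have ij: "i + j = 2"
      unfolding i_def j_def using card_Diff_subset_Int[of e U] card_mono[of e "e \<inter> U"]
        \<open>finite e\<close> e(2) by simp
    \<comment> \<open>If \<open>e\<close> enters \<open>H\<close>, its \<open>j\<close> ends in
      \<open>U\<close> become covered and leave the potential; if it becomes a candidate, its
      \<open>i\<close> new ends join.\<close>
    have d1: "?d U (insert e G) + j = ?d U G"
    proof -
      have "U - \<Union>G = (U - \<Union>(insert e G)) \<union> (e \<inter> U)" using True by auto
      then show ?thesis using Cons.prems(4) \<open>finite e\<close>
        unfolding j_def by (subst \<open>U - \<Union>G = _\<close>, subst card_Un_disjoint) auto
    qed
    have d2: "?d (U \<union> e) G = ?d U G + i"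
    proof -
      have "(U \<union> e) - \<Union>G = (U - \<Union>G) \<union> (e - U)" using True by auto
      then show ?thesis using Cons.prems(4) \<open>finite e\<close>
        unfolding i_def by (subst \<open>(U \<union> e) - \<Union>G = _\<close>, subst card_Un_disjoint) auto
    qed
    have "p * ?A U (insert e G) + (1 - p) * (2 * p * w e + ?A (U \<union> e) G) \<le>
        p * (?B U (insert e G) + (1 - p) * w e * ?d U (insert e G)) +
        (1 - p) * (2 * p * w e + (?B (U \<union> e) G + (1 - p) * w e * ?d (U \<union> e) G))"
      using Cons.prems(4) \<open>finite e\<close> assms(6,7)
      by (intro add_mono mult_left_mono IH order_refl) auto
    \<comment> \<open>The potential balances exactly: up to the common factor
      \<open>(1 - p) * w e\<close>, this is -p (2 - i) + 2 p + (1 - p) i = i.\<close>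
    also have "\<dots> = p * ?B U (insert e G) + (1 - p) * (i * w e + ?B (U \<union> e) G) +
        (1 - p) * w e * ?d U G"
    proof -
      have "?d U (insert e G) = ?d U G - j" "j = 2 - i" using d1 ij by auto
      moreover have "p * (b + (1 - p) * v * (d - (2 - i))) +
          (1 - p) * (2 * p * v + (b' + (1 - p) * v * (d + i))) =
          p * b + (1 - p) * (i * v + b') + (1 - p) * v * d" for b b' v d :: real
        by algebra
      ultimately show ?thesis unfolding d2 by simp
    qed
    also have "(1 - p) * w e * ?d U G \<le> (1 - p) * B * ?d U G"
      using e assms(7) by (intro mult_right_mono mult_left_mono) auto
    finally show ?thesis
      by (subst (1 2) coin_avg_candidates_free[OF e(1) True]) (simp add: coin_avg_add i_def)
  next
    case False
    have "?A U G \<le> ?B U G + (1 - p) * w e * ?d U G" by (rule IH[OF Cons.prems(4)])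
    also have "\<dots> \<le> ?B U G + (1 - p) * B * ?d U G"
      using e assms(7) by (intro add_left_mono mult_right_mono mult_left_mono) auto
    finally show ?thesis
      by (subst (1 2) coin_avg_candidates_blocked[OF e(1) False])
  qed
qed

section \<open>The greedy matching against candidates and optimum\<close>

text \<open>The coin of a free edge adds \<open>p * w e\<close> in expectation to the greedy
  matching and \<open>(1 - p) * w e\<close> to the candidates. The weight of \<open>G\<close> is
  subtracted because it is there from the start.\<close>

lemma coin_avg_candidates_greedy:
  assumes "distinct es" "{} \<notin> set es" "finite G"
  shows "p * coin_avg (\<lambda>_. p) es (\<lambda>H. score (\<lambda>_ _ _. 1) w U (candidates es H G)) =
    (1 - p) * (coin_avg (\<lambda>_. p) es (\<lambda>H. sum w (greedy_from es H G)) - sum w G)"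
  using assms
proof (induction es arbitrary: G U)
  case (Cons e es)
  let ?S = "\<lambda>U G. coin_avg (\<lambda>_. p) es (\<lambda>H. score (\<lambda>_ _ _. 1) w U (candidates es H G))"
  let ?T = "\<lambda>G. coin_avg (\<lambda>_. p) es (\<lambda>H. sum w (greedy_from es H G))"
  have IH: "p * ?S U G = (1 - p) * (?T G - sum w G)" if "finite G" for U G
    using Cons that by simp
  have e: "e \<notin> set es" "e \<noteq> {}" using Cons.prems by auto
  have T: "coin_avg (\<lambda>_. p) (e # es) (\<lambda>H. sum w (greedy_from (e # es) H G)) =
      p * ?T (add_if_free e G) + (1 - p) * ?T G"
  proof -
    have "coin_avg (\<lambda>_. p) es (\<lambda>H. sum w (greedy_from (e # es) (insert e H) G)) =
        ?T (add_if_free e G)"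
      using e by (intro coin_avg_cong refl arg_cong[where f = "sum w"])
        (auto intro!: arg_cong[where f = "\<lambda>xs. fold add_if_free xs _"] filter_cong)
    moreover have "coin_avg (\<lambda>_. p) es (\<lambda>H. sum w (greedy_from (e # es) H G)) = ?T G"
      using e by (intro coin_avg_cong refl arg_cong[where f = "sum w"]) auto
    ultimately show ?thesis by simp
  qed
  show ?case
  proof (cases "e \<inter> \<Union>G = {}")
    case True
    then have "e \<notin> G" using e by auto
    then have w: "sum w (insert e G) = w e + sum w G" using Cons.prems by simp
    have "p * (p * ?S U (insert e G) + (1 - p) * (w e + ?S (U \<union> e) G)) =
        p * (p * ?S U (insert e G)) + (1 - p) * (p * w e + p * ?S (U \<union> e) G)"
      by (simp add: algebra_simps)
    also have "\<dots> = p * ((1 - p) * (?T (insert e G) - sum w (insert e G))) +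
        (1 - p) * (p * w e + (1 - p) * (?T G - sum w G))"
      using Cons.prems IH[of "insert e G" U] IH[of G "U \<union> e"] by simp
    also have "\<dots> = (1 - p) * (p * ?T (insert e G) + (1 - p) * ?T G - sum w G)"
      unfolding w by (simp add: algebra_simps)
    finally show ?thesis
      unfolding T using True
      by (subst coin_avg_candidates_free[OF e(1) True]) (simp add: coin_avg_add add_if_free_def)
  next
    case False
    then show ?thesis
      using IH[of G U] Cons.prems unfolding T
      by (subst coin_avg_candidates_blocked[OF e(1) False])
        (simp add: add_if_free_def algebra_simps)
  qed
qed simp

text \<open>At the turn of \<open>e\<close>, either an edge of weight at least \<open>w e\<close>
  already covers one of its ends, or \<open>e\<close> is free and with probability
  \<open>q e\<close> covers both ends itself. Greedy never removes an edge, so this contribution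
  survives.\<close>

lemma coin_avg_greedy_near_edge:
  assumes "distinct es" "sorted_wrt (\<lambda>e f. w e \<ge> w f) es" "finite G"
    "\<And>e. e \<in> set es \<Longrightarrow> card e = 2 \<and> 0 \<le> w e"
    "\<And>e. e \<in> set es \<Longrightarrow> 0 \<le> q e \<and> q e \<le> 1"
    "\<And>g f. g \<in> G \<Longrightarrow> f \<in> set es \<Longrightarrow> w f \<le> w g" "\<And>g. g \<in> G \<Longrightarrow> 0 \<le> w g"
    "e \<in> set es"
  shows "min 1 (2 * q e) * w e \<le>
    coin_avg q es (\<lambda>H. \<Sum>g\<in>greedy_from es H G. real (card (e \<inter> g)) * w g)"
  using assms
proof (induction es arbitrary: G)
  case (Cons x xs)
  let ?f = "\<lambda>K. \<Sum>g\<in>K. real (card (e \<inter> g)) * w g"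
  have x: "x \<notin> set xs" "0 \<le> q x" "q x \<le> 1" "0 \<le> w x" using Cons.prems by auto
  have "finite e" using Cons.prems by (metis card.infinite zero_neq_numeral)
  have bound: "?f {g} \<le> ?f (greedy_from es' H G')"
    if "g \<in> G'" "finite G'" "\<And>g. g \<in> G' \<union> set es' \<Longrightarrow> 0 \<le> w g" for g es' H G'
    using that greedy_from_mono[of G' H es'] greedy_from_subset[of H es' G'] finite_greedy_from[of G' H es']
    by (intro sum_mono2) auto
  have nn: "0 \<le> ?f (greedy_from es' H G')"
    if "\<And>g. g \<in> G' \<union> set es' \<Longrightarrow> 0 \<le> w g" for es' H G'
    using that greedy_from_subset[of H es' G'] by (intro sum_nonneg) auto
  have split: "coin_avg q (x # xs) (\<lambda>H. ?f (greedy_from (x # xs) H G)) =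
      q x * coin_avg q xs (\<lambda>H. ?f (greedy_from xs H (add_if_free x G))) +
      (1 - q x) * coin_avg q xs (\<lambda>H. ?f (greedy_from xs H G))"
  proof -
    have "coin_avg q xs (\<lambda>H. ?f (greedy_from (x # xs) (insert x H) G)) =
        coin_avg q xs (\<lambda>H. ?f (greedy_from xs H (add_if_free x G)))"
      using x by (intro coin_avg_cong refl arg_cong[where f = ?f])
        (auto intro!: arg_cong[where f = "\<lambda>xs. fold add_if_free xs _"] filter_cong)
    moreover have "coin_avg q xs (\<lambda>H. ?f (greedy_from (x # xs) H G)) =
        coin_avg q xs (\<lambda>H. ?f (greedy_from xs H G))"
      using x by (intro coin_avg_cong refl arg_cong[where f = ?f]) auto
    ultimately show ?thesis by simp
  qed
  have q: "0 \<le> q y \<and> q y \<le> 1" if "y \<in> set xs" for y using that Cons.prems by auto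
  show ?case
  proof (cases "x = e")
    case True
    have w0: "0 \<le> w g" if "g \<in> G \<union> set xs" for g
      using that Cons.prems by auto
    have wx0: "0 \<le> w g" if "g \<in> add_if_free x G \<union> set xs" for g
      using that x w0 by (auto simp: add_if_free_def split: if_splits)
    show ?thesis
    proof (cases "e \<inter> \<Union>G = {}")
      case free: True
      have "2 * w e \<le> ?f (greedy_from xs H (insert e G))" for H
      proof -
        have "?f {e} \<le> ?f (greedy_from xs H (insert e G))"
          using Cons.prems(3) True w0 x by (intro bound) auto
        then show ?thesis using Cons.prems(4) True by simp
      qed
      then have "coin_avg q xs (\<lambda>_. 2 * w e) \<le>
          coin_avg q xs (\<lambda>H. ?f (greedy_from xs H (add_if_free x G)))"
        using q free True by (intro coin_avg_mono) (auto simp: add_if_free_def)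
      \<comment> \<open>If \<open>e\<close> is not sampled, only nonnegativity is used.\<close>
      moreover have "coin_avg q xs (\<lambda>_. 0) \<le> coin_avg q xs (\<lambda>H. ?f (greedy_from xs H G))"
        using q w0 by (intro coin_avg_mono nn) auto
      ultimately have "q x * (2 * w e) + (1 - q x) * 0 \<le>
          coin_avg q (x # xs) (\<lambda>H. ?f (greedy_from (x # xs) H G))"
        unfolding split using x by (intro add_mono mult_left_mono) auto
      moreover have "min 1 (2 * q e) * w e \<le> 2 * q e * w e"
        using x True by (intro mult_right_mono) auto
      ultimately show ?thesis using True by simp
    next
      case False
      then obtain g where g: "g \<in> G" "e \<inter> g \<noteq> {}" by auto
      then have "1 \<le> card (e \<inter> g)" using \<open>finite e\<close> by (simp add: Suc_le_eq card_gt_0_iff)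
      then have "1 * w e \<le> real (card (e \<inter> g)) * w g"
        using Cons.prems g x True by (intro mult_mono) auto
      then have "w e \<le> ?f (greedy_from xs H G)" for H
        using bound[of g G xs H] g w0 Cons.prems(3) by auto
      then have "coin_avg q xs (\<lambda>_. w e) \<le> coin_avg q xs (\<lambda>H. ?f (greedy_from xs H G))"
        using q by (intro coin_avg_mono) auto
      moreover have "min 1 (2 * q e) * w e \<le> 1 * w e"
        using x True by (intro mult_right_mono) auto
      ultimately show ?thesis
        unfolding split using False True by (simp add: add_if_free_def algebra_simps)
    qed
  next
    case False
    \<comment> \<open>Before the turn of \<open>e\<close> the bound holds for both outcomes of the
      coin of \<open>x\<close>, hence on average.\<close>
    have 1: "min 1 (2 * q e) * w e \<le> coin_avg q xs (\<lambda>H. ?f (greedy_from xs H (add_if_free x G)))"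
      using Cons.prems False
      by (intro Cons.IH) (auto simp: add_if_free_def split: if_splits)
    have 2: "min 1 (2 * q e) * w e \<le> coin_avg q xs (\<lambda>H. ?f (greedy_from xs H G))"
      using Cons.prems False by (intro Cons.IH) auto
    have "q x * (min 1 (2 * q e) * w e) + (1 - q x) * (min 1 (2 * q e) * w e) \<le>
        coin_avg q (x # xs) (\<lambda>H. ?f (greedy_from (x # xs) H G))"
      unfolding split using x by (intro add_mono mult_left_mono 1 2) auto
    then show ?thesis by (simp add: algebra_simps)
  qed
qed simp

text \<open>Summing over \<open>M\<close> counts a greedy edge once for each of its ends on
  \<open>M\<close>, hence at most twice, because \<open>M\<close> is disjoint.\<close>

lemma coin_avg_greedy_matching:
  assumes "distinct es" "sorted_wrt (\<lambda>e f. w e \<ge> w f) es"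
    "\<And>e. e \<in> set es \<Longrightarrow> card e = 2 \<and> 0 \<le> w e"
    "\<And>e. e \<in> set es \<Longrightarrow> 0 \<le> q e \<and> q e \<le> 1"
    "M \<subseteq> set es" "pairwise disjnt M" "\<And>e. e \<in> M \<Longrightarrow> q e = r"
  shows "min 1 (2 * r) * sum w M \<le> 2 * coin_avg q es (\<lambda>H. sum w (greedy es H))"
proof -
  have "min 1 (2 * r) * sum w M = (\<Sum>e\<in>M. min 1 (2 * q e) * w e)"
    using assms(7) by (simp add: sum_distrib_left)
  also have "\<dots> \<le> (\<Sum>e\<in>M. coin_avg q es (\<lambda>H. \<Sum>g\<in>greedy es H. real (card (e \<inter> g)) * w g))"
    unfolding greedy_def using assms by (intro sum_mono coin_avg_greedy_near_edge) auto
  also have "\<dots> = coin_avg q es (\<lambda>H. \<Sum>e\<in>M. \<Sum>g\<in>greedy es H. real (card (e \<inter> g)) * w g)"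
    by (rule coin_avg_sum[symmetric])
  also have "\<dots> \<le> coin_avg q es (\<lambda>H. 2 * sum w (greedy es H))"
  proof (rule coin_avg_mono)
    fix H
    have sub: "greedy es H \<subseteq> set es"
      using greedy_from_subset[of H es "{}"] by (auto simp: greedy_def)
    have "(\<Sum>e\<in>M. \<Sum>g\<in>greedy es H. real (card (e \<inter> g)) * w g) =
        (\<Sum>g\<in>greedy es H. real (\<Sum>e\<in>M. card (e \<inter> g)) * w g)"
      by (subst sum.swap) (simp add: sum_distrib_right)
    also have "\<dots> \<le> (\<Sum>g\<in>greedy es H. 2 * w g)"
    proof (intro sum_mono mult_right_mono)
      fix g assume "g \<in> greedy es H"
      then have g: "card g = 2" "0 \<le> w g" using sub assms(3) by auto
      then have fin: "finite g" by (metis card.infinite zero_neq_numeral)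
      have "(\<Sum>e\<in>M. card (e \<inter> g)) = card (\<Union>e\<in>M. e \<inter> g)"
        using assms(5,6) fin finite_subset[OF assms(5)]
        by (intro card_UN_disjoint[symmetric]) (auto simp: pairwise_def disjnt_def)
      also have "\<dots> \<le> card g" using fin by (intro card_mono) auto
      finally show "real (\<Sum>e\<in>M. card (e \<inter> g)) \<le> 2" using g by linarith
      show "0 \<le> w g" by fact
    qed
    finally show "(\<Sum>e\<in>M. \<Sum>g\<in>greedy es H. real (card (e \<inter> g)) * w g) \<le> 2 * sum w (greedy es H)"
      by (simp add: sum_distrib_left)
  qed (use assms in auto)
  finally show ?thesis by (simp add: coin_avg_cmult)
qed

lemma ex_max_weight:
  assumes "finite F"
  obtains M where "M \<subseteq> F" "matching M" "max_weight w F = sum w M"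
proof -
  let ?W = "{sum w M | M. M \<subseteq> F \<and> matching M}"
  have "?W \<subseteq> sum w ` Pow F" by auto
  then have "finite ?W" using assms by (meson finite_Pow_iff finite_imageI finite_subset)
  moreover have "sum w {} \<in> ?W" by (auto simp: matching_def intro!: exI[of _ "{}"])
  ultimately have "Max ?W \<in> ?W" by (intro Max_in) auto
  then show ?thesis using that by (auto simp: max_weight_def)
qed

text \<open>Given \<open>F\<close>, an optimal matching of \<open>F\<close> is fixed, while each of
  its edges still lies in \<open>H\<close> with probability \<open>r\<close>, independently.
  Averaging over \<open>F\<close> removes the conditioning.\<close>

lemma coin_avg_greedy_max_weight:
  assumes "distinct es" "sorted_wrt (\<lambda>e f. w e \<ge> w f) es"
    "\<And>e. e \<in> set es \<Longrightarrow> card e = 2 \<and> 0 \<le> w e"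
    "0 \<le> p" "p \<le> 1" "0 \<le> r" "r \<le> 1" "0 \<le> s" "s \<le> 1" "(1 - p) * r + p * s = p"
  shows "min 1 (2 * r) * coin_avg (\<lambda>_. p) es (\<lambda>H. max_weight w (set es - H)) \<le>
    2 * coin_avg (\<lambda>_. p) es (\<lambda>H. sum w (greedy es H))"
proof -
  let ?g = "\<lambda>F. coin_avg (\<lambda>x. if x \<in> F then r else s) es (\<lambda>H. sum w (greedy es H))"
  have "min 1 (2 * r) * coin_avg (\<lambda>_. p) es (\<lambda>H. max_weight w (set es - H)) =
      coin_avg (\<lambda>_. 1 - p) es (\<lambda>F. min 1 (2 * r) * max_weight w F)"
    by (simp add: coin_avg_complement[OF assms(1)] coin_avg_cmult)
  also have "\<dots> \<le> coin_avg (\<lambda>_. 1 - p) es (\<lambda>F. 2 * ?g F)"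
  proof (rule coin_avg_mono)
    fix F assume F: "F \<subseteq> set es"
    then obtain M where M: "M \<subseteq> F" "matching M" "max_weight w F = sum w M"
      using ex_max_weight[of F w] finite_subset by blast
    show "min 1 (2 * r) * max_weight w F \<le> 2 * ?g F"
      unfolding M(3) using assms M F
      by (intro coin_avg_greedy_matching) (auto simp: matching_def)
  qed (use assms in auto)
  also have "\<dots> = 2 * coin_avg (\<lambda>_. p) es (\<lambda>H. sum w (greedy es H))"
    by (simp add: coin_avg_cmult coin_avg_two_stage[OF assms(1,10)])
  finally show ?thesis .
qed

section \<open>Charging to a maximal matching\<close>

text \<open>At its turn an edge satisfying \<open>P\<close> is added or blocked; since the matching
  only grows, the edge meets the final one.\<close>

lemma fold_add_if_free_cond:
  assumes "R = fold (\<lambda>e M. if P e then add_if_free e M else M) xs M0" "{} \<notin> set xs"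
    "pairwise disjnt M0"
  shows "pairwise disjnt R \<and> M0 \<subseteq> R \<and> R \<subseteq> M0 \<union> {e \<in> set xs. P e} \<and>
    (\<forall>e\<in>set xs. P e \<longrightarrow> e \<inter> \<Union>R \<noteq> {})"
  using assms
proof (induction xs arbitrary: M0)
  case (Cons x xs)
  define M1 where "M1 = (if P x then add_if_free x M0 else M0)"
  have M1: "pairwise disjnt M1" "M0 \<subseteq> M1" "M1 \<subseteq> M0 \<union> {e. e = x \<and> P e}"
    using Cons.prems disjnt_add_if_free[of M0 x]
    by (auto simp only: M1_def) (auto simp: add_if_free_def split: if_splits)
  \<comment> \<open>An edge that was just added meets the matching because it is nonempty.\<close>
  have "x \<inter> \<Union>M1 \<noteq> {}" if "P x"
    using that Cons.prems by (auto simp: M1_def add_if_free_def)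
  moreover have R: "pairwise disjnt R \<and> M1 \<subseteq> R \<and> R \<subseteq> M1 \<union> {e \<in> set xs. P e} \<and>
      (\<forall>e\<in>set xs. P e \<longrightarrow> e \<inter> \<Union>R \<noteq> {})"
    using Cons.prems M1 by (intro Cons.IH) (auto simp: M1_def)
  ultimately show ?case using M1 by fastforce
qed simp

text \<open>Maximality is all that is kept of the arrival order, so the bounds here are
  deterministic and hold for every adversary. Earlier and later refer to the order by weight in
  \<open>cs\<close>.\<close>

locale maximal_matching =
  fixes w :: "'v edge \<Rightarrow> real" and cs :: "'v edge list" and M :: "'v edge set"
  assumes sorted: "sorted_wrt (\<lambda>e f. w e \<ge> w f) cs"
    and edge: "\<And>e. e \<in> set cs \<Longrightarrow> card e = 2 \<and> 0 \<le> w e"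
    and sub: "M \<subseteq> set cs"
    and disj: "pairwise disjnt M"
    and maximal: "\<And>e. e \<in> set cs \<Longrightarrow> e \<inter> \<Union>M \<noteq> {}"
begin

lemma finite_edge: "e \<in> set cs \<Longrightarrow> finite e"
  using edge by (metis card.infinite zero_neq_numeral)

lemma finite_M: "finite M"
  using sub finite_subset by blast

lemma weight_nonneg: "f \<in> M \<Longrightarrow> 0 \<le> w f"
  using sub edge by auto

lemma weight_le:
  assumes "cs = as @ e # ds" "f \<in> M" "u \<in> f" "u \<notin> \<Union>(set ds)"
  shows "w e \<le> w f"
proof -
  have "f \<in> set as \<union> {e}" using assms sub by auto
  then show ?thesis using sorted assms(1) by (auto simp: sorted_wrt_append)
qed

text \<open>The left side is the charge on \<open>X\<close>: each edge of \<open>M\<close> pays its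
  weight at each of its ends in \<open>X\<close>, and it has only two ends.\<close>

lemma sum_charges: "(\<Sum>f\<in>M. w f * real (card (f \<inter> X))) \<le> 2 * sum w M"
  unfolding sum_distrib_left
proof (rule sum_mono)
  fix f assume f: "f \<in> M"
  then have "f \<in> set cs" using sub by auto
  then have "card (f \<inter> X) \<le> 2"
    using card_mono[of f "f \<inter> X"] edge[of f] finite_edge[of f] by auto
  then show "w f * real (card (f \<inter> X)) \<le> 2 * w f"
    using weight_nonneg[OF f] mult_left_mono[of "real (card (f \<inter> X))" 2 "w f"] by simp
qed

lemma charge_split:
  assumes "X \<inter> Y = {}"
  shows "(\<Sum>f\<in>M. w f * real (card (f \<inter> (X \<union> Y)))) =
    (\<Sum>f\<in>M. w f * real (card (f \<inter> X))) + (\<Sum>f\<in>M. w f * real (card (f \<inter> Y)))"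
  unfolding sum.distrib[symmetric]
proof (rule sum.cong[OF refl])
  fix f assume f: "f \<in> M"
  then have "finite f" using sub finite_edge by auto
  then have "card (f \<inter> (X \<union> Y)) = card (f \<inter> X) + card (f \<inter> Y)"
    using assms by (subst card_Un_disjoint[symmetric]) (auto simp: Int_Un_distrib)
  then show "w f * real (card (f \<inter> (X \<union> Y))) = w f * real (card (f \<inter> X)) + w f * real (card (f \<inter> Y))"
    by (simp add: algebra_simps)
qed

lemma charge_mono:
  assumes "X \<subseteq> Y"
  shows "(\<Sum>f\<in>M. w f * real (card (f \<inter> X))) \<le> (\<Sum>f\<in>M. w f * real (card (f \<inter> Y)))"
proof (intro sum_mono mult_left_mono)
  fix f assume f: "f \<in> M"
  then have "finite f" using sub finite_edge by auto
  then show "real (card (f \<inter> X)) \<le> real (card (f \<inter> Y))"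
    using assms by (auto intro!: card_mono)
qed (rule weight_nonneg)

text \<open>Each vertex of \<open>X\<close> lies on exactly one edge of \<open>M\<close>, which pays
  at least \<open>c\<close> there.\<close>

lemma charge_covered:
  assumes "X \<subseteq> \<Union>M" "finite X" "\<And>f u. f \<in> M \<Longrightarrow> u \<in> f \<inter> X \<Longrightarrow> c \<le> w f"
  shows "real (card X) * c \<le> (\<Sum>f\<in>M. w f * real (card (f \<inter> X)))"
proof -
  have "X = (\<Union>f\<in>M. f \<inter> X)" using assms(1) by auto
  then have "card X = card (\<Union>f\<in>M. f \<inter> X)" by simp
  also have "\<dots> = (\<Sum>f\<in>M. card (f \<inter> X))"
    using disj finite_M assms(2)
    by (intro card_UN_disjoint) (auto simp: pairwise_def disjnt_def)
  finally have "real (card X) * c = (\<Sum>f\<in>M. c * real (card (f \<inter> X)))"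
    by (simp add: sum_distrib_left mult.commute)
  also have "\<dots> \<le> (\<Sum>f\<in>M. w f * real (card (f \<inter> X)))"
  proof (rule sum_mono)
    fix f assume "f \<in> M"
    then show "c * real (card (f \<inter> X)) \<le> w f * real (card (f \<inter> X))"
      using assms(3)[of f] by (cases "f \<inter> X = {}") (auto intro!: mult_right_mono)
  qed
  finally show ?thesis .
qed

text \<open>If \<open>e\<close> is in \<open>M\<close>, both its ends are covered. Otherwise it
  meets an edge of \<open>M\<close>, necessarily an earlier one, so at most one end of
  \<open>e\<close> is first while at least one is covered. The covering edges weigh at least
  \<open>w e\<close>.\<close>

lemma charge_isolated_later:
  assumes "cs = as @ e # ds" "e \<inter> \<Union>(set ds) = {}"
  shows "max 1 (real (card (e - \<Union>(set as)))) * w e \<le> (\<Sum>f\<in>M. w f * real (card (f \<inter> e)))"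
proof -
  have e: "e \<in> set cs" using assms by simp
  let ?X = "e \<inter> \<Union>M"
  have fin: "finite e" using finite_edge e by simp
  have "max 1 (card (e - \<Union>(set as))) \<le> card ?X"
  proof (cases "e \<in> M")
    case True
    then have "?X = e" by auto
    then show ?thesis using card_mono[of e "e - \<Union>(set as)"] fin edge[OF e] by auto
  next
    case False
    obtain f u where f: "f \<in> M" "u \<in> e" "u \<in> f" using maximal[OF e] by auto
    have "f \<in> set as" using f False sub assms by auto
    then have "e - \<Union>(set as) \<subset> e" using f by auto
    then have "card (e - \<Union>(set as)) < 2" using psubset_card_mono[OF fin] edge[OF e] by metis
    moreover have "0 < card ?X" using f fin by (auto simp: card_gt_0_iff)
    ultimately show ?thesis by simp
  qed
  then have "max 1 (real (card (e - \<Union>(set as)))) * w e \<le> real (card ?X) * w e"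
    using edge[OF e] by (intro mult_right_mono) auto
  also have "\<dots> \<le> (\<Sum>f\<in>M. w f * real (card (f \<inter> ?X)))"
    using fin assms by (intro charge_covered) (auto intro: weight_le)
  also have "\<dots> \<le> (\<Sum>f\<in>M. w f * real (card (f \<inter> e)))" by (rule charge_mono) auto
  finally show ?thesis .
qed

text \<open>Edges that meet no later edge are pairwise disjoint, so their charges fall on disjoint
  vertex sets.\<close>

lemma score_isolated_later:
  "score (\<lambda>U e X. if e \<inter> X = {} then max 1 (real (card (e - U))) else 0) w {} cs \<le> 2 * sum w M"
proof -
  let ?s = "\<lambda>U e X. if e \<inter> X = {} then max 1 (real (card (e - U))) else 0"
  \<comment> \<open>\<open>Y\<close> collects the ends of the counted edges of the suffix; lying
    inside later edges, it is disjoint from a newly counted \<open>e\<close>.\<close>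
  have "\<exists>Y \<subseteq> \<Union>(set ds). score ?s w (\<Union>(set as)) ds \<le> (\<Sum>f\<in>M. w f * real (card (f \<inter> Y)))"
    if "cs = as @ ds" for as ds
    using that
  proof (induction ds arbitrary: as)
    case (Cons e ds)
    have snoc: "cs = (as @ [e]) @ ds" "\<Union>(set (as @ [e])) = \<Union>(set as) \<union> e"
      using Cons.prems by auto
    obtain Y where Y: "Y \<subseteq> \<Union>(set ds)"
      "score ?s w (\<Union>(set as) \<union> e) ds \<le> (\<Sum>f\<in>M. w f * real (card (f \<inter> Y)))"
      using Cons.IH[OF snoc(1)] unfolding snoc(2) by blast
    show ?case
    proof (cases "e \<inter> \<Union>(set ds) = {}")
      case True
      have "score ?s w (\<Union>(set as)) (e # ds) \<le> (\<Sum>f\<in>M. w f * real (card (f \<inter> (e \<union> Y))))"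
      proof (subst charge_split)
        show "e \<inter> Y = {}" using True Y(1) by blast
        show "score ?s w (\<Union>(set as)) (e # ds) \<le>
            (\<Sum>f\<in>M. w f * real (card (f \<inter> e))) + (\<Sum>f\<in>M. w f * real (card (f \<inter> Y)))"
          unfolding score.simps if_P[OF True]
          by (rule add_mono[OF charge_isolated_later[OF Cons.prems True] Y(2)])
      qed
      then show ?thesis using Y(1) by (intro exI[of _ "e \<union> Y"]) auto
    next
      case False
      then have "score ?s w (\<Union>(set as)) (e # ds) = score ?s w (\<Union>(set as) \<union> e) ds"
        by (simp only: score.simps if_False mult_zero_left add_0_left)
      then show ?thesis using Y by (intro exI[of _ Y]) auto
    qed
  qed simp
  from this[of "[]" cs] obtain Y where
    "score ?s w {} cs \<le> (\<Sum>f\<in>M. w f * real (card (f \<inter> Y)))"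
    by auto
  then show ?thesis using sum_charges[of Y]
    by (rule order_trans)
qed

text \<open>Maximality leaves at most one end of \<open>e\<close> uncovered, and none if
  \<open>e\<close> is in \<open>M\<close>. A covered end on no later edge is paid for by an edge at
  least as heavy as \<open>e\<close>.\<close>

lemma charge_last_ends:
  assumes "cs = as @ e # ds"
  shows "real (card (e - \<Union>(set ds))) * w e \<le>
    of_bool (e \<notin> M) * w e + (\<Sum>f\<in>M. w f * real (card (f \<inter> (e - \<Union>(set ds)))))"
proof -
  let ?L = "e - \<Union>(set ds)"
  have e: "e \<in> set cs" using assms by simp
  have fin: "finite e" using finite_edge e by simp
  have "card (e - \<Union>M) \<le> of_bool (e \<notin> M)"
  proof (cases "e \<in> M")
    case True
    then have "e - \<Union>M = {}" by auto
    then show ?thesis by (simp only: card.empty)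
  next
    case False
    have "e - \<Union>M \<subset> e" using maximal[OF e] by auto
    then have "card (e - \<Union>M) < 2" using psubset_card_mono[OF fin] edge[OF e] by metis
    then show ?thesis using False by simp
  qed
  moreover have "card ?L \<le> card (e - \<Union>M) + card (?L \<inter> \<Union>M)"
  proof -
    have "card ?L \<le> card ((e - \<Union>M) \<union> (?L \<inter> \<Union>M))" using fin by (intro card_mono) auto
    also have "\<dots> \<le> card (e - \<Union>M) + card (?L \<inter> \<Union>M)" by (rule card_Un_le)
    finally show ?thesis .
  qed
  ultimately have "real (card ?L) \<le> of_bool (e \<notin> M) + real (card (?L \<inter> \<Union>M))"
    by (auto simp: of_bool_def split: if_splits)
  then have "real (card ?L) * w e \<le> (of_bool (e \<notin> M) + real (card (?L \<inter> \<Union>M))) * w e"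
    using edge[OF e] by (intro mult_right_mono) auto
  moreover have "real (card (?L \<inter> \<Union>M)) * w e \<le> (\<Sum>f\<in>M. w f * real (card (f \<inter> (?L \<inter> \<Union>M))))"
    using fin assms by (intro charge_covered) (auto intro: weight_le)
  moreover have "\<dots> \<le> (\<Sum>f\<in>M. w f * real (card (f \<inter> ?L)))"
    by (rule charge_mono) auto
  ultimately show ?thesis by (simp add: algebra_simps)
qed

text \<open>A vertex is last for at most one edge, so the charges at last ends total at most
  \<open>2 * sum w M\<close>. Uncovered ends add at most the weight of the candidates outside
  \<open>M\<close>.\<close>

lemma score_last_ends:
  assumes "distinct cs"
  shows "score (\<lambda>U e X. card (e - X)) w {} cs \<le> sum w (set cs) + sum w M"
proof -
  have "score (\<lambda>U e X. card (e - X)) w U ds \<le>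
      (\<Sum>e\<in>set ds. of_bool (e \<notin> M) * w e) + (\<Sum>f\<in>M. w f * real (card (f \<inter> \<Union>(set ds))))"
    if "cs = as @ ds" for U as ds
    using that
  proof (induction ds arbitrary: U as)
    case (Cons e ds)
    let ?L = "e - \<Union>(set ds)"
    have "e \<notin> set ds" using assms Cons.prems by simp
    then have 1: "(\<Sum>f\<in>set (e # ds). of_bool (f \<notin> M) * w f) =
        of_bool (e \<notin> M) * w e + (\<Sum>f\<in>set ds. of_bool (f \<notin> M) * w f)"
      by simp
    have "\<Union>(set (e # ds)) = ?L \<union> \<Union>(set ds)" by auto
    then have 2: "(\<Sum>f\<in>M. w f * real (card (f \<inter> \<Union>(set (e # ds))))) =
        (\<Sum>f\<in>M. w f * real (card (f \<inter> ?L))) + (\<Sum>f\<in>M. w f * real (card (f \<inter> \<Union>(set ds))))"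
      using charge_split[of ?L "\<Union>(set ds)"] by auto
    show ?case
      unfolding 1 2 score.simps
      using charge_last_ends[OF Cons.prems] Cons.IH[of "as @ [e]" "U \<union> e"] Cons.prems
      by simp
  qed simp
  from this[of "[]" cs "{}"]
  have "score (\<lambda>U e X. card (e - X)) w {} cs \<le> (\<Sum>e\<in>set cs. of_bool (e \<notin> M) * w e) + 2 * sum w M"
    using sum_charges[of "\<Union>(set cs)"] by simp
  also have "(\<Sum>e\<in>set cs. of_bool (e \<notin> M) * w e) = sum w (set cs - M)"
    by (rule sum.mono_neutral_cong_right) auto
  also have "\<dots> = sum w (set cs) - sum w M" using sub by (intro sum_diff) auto
  finally show ?thesis by simp
qed

end

section \<open>Expected weight of the output\<close>

text \<open>The arrivals passing the test are exactly the candidates, and each is added if free.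
  Here the arrival order drops out of the analysis.\<close>

lemma (in weighted_graph) maximal_matching_greedy_based:
  assumes "set arrivals = E - H"
  shows "maximal_matching w (candidates rk H {}) (greedy_based rk H arrivals)"
proof -
  have "{} \<notin> E" using edges[of "{}"] by auto
  then have empty: "{} \<notin> set rk" "{} \<notin> set arrivals" using assms ranking(2) by auto
  have cand: "set (candidates rk H {}) = {e \<in> set arrivals. e \<in> greedy rk (insert e H)}"
    using in_candidates_iff[OF ranking(1) _ empty(1), of "{}" _ H] assms ranking(2)
    by (auto simp: greedy_def)
  have "sorted_wrt (\<lambda>e f. w e \<ge> w f) (candidates rk H {})"
    using ranking(3) by (rule sorted_candidates)
  moreover have "card e = 2 \<and> 0 \<le> w e" if "e \<in> set (candidates rk H {})" for e
    using that set_candidates_subset[of rk H "{}"] ranking(2) edges weight_nonneg by blast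
  ultimately show ?thesis
    using fold_add_if_free_cond[of "greedy_based rk H arrivals"
        "\<lambda>e. e \<in> greedy rk (insert e H)" arrivals "{}"] empty(2)
    by unfold_locales (auto simp: cand greedy_based_def)
qed

context weighted_graph
begin

lemma edge_props: "e \<in> set rk \<Longrightarrow> card e = 2 \<and> 0 \<le> w e"
  using edges weight_nonneg ranking(2) by auto

text \<open>A candidate meets no later candidate with conditional probability at least
  \<open>p ^ 2\<close>, whatever its number of first ends. Bounding \<open>max 1\<close> from below
  by 1 gives the first term; bounding it by the number of first ends, which averages to a weighted
  share \<open>p\<close>, gives the second.\<close>

lemma coin_avg_isolated_later:
  assumes p: "0 \<le> p" "p \<le> 1"
  shows "max (p ^ 2) (2 * p ^ 3) *
      coin_avg (\<lambda>_. p) rk (\<lambda>H. score (\<lambda>_ _ _. 1) w {} (candidates rk H {})) \<le>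
    coin_avg (\<lambda>_. p) rk (\<lambda>H.
      score (\<lambda>U e X. if e \<inter> X = {} then max 1 (real (card (e - U))) else 0) w {} (candidates rk H {}))"
    (is "_ * ?C \<le> ?L")
proof -
  let ?m = "\<lambda>U e. p ^ 2 * max 1 (real (card (e - U)))"
  have L: "coin_avg (\<lambda>_. p) rk (\<lambda>H. score (\<lambda>U e _. ?m U e) w {} (candidates rk H {})) \<le> ?L"
  proof (rule coin_avg_score_mono)
    fix es' :: "'v edge list" and e :: "'v edge" and G :: "'v edge set" and U :: "'v set"
    assume es': "distinct es'" and e: "e \<in> set rk" and free: "e \<inter> \<Union>G = {}"
    have "e - \<Union>G = e" using free by auto
    moreover have "card e = 2" "finite e"
      using edge_props[OF e] by (auto intro: card_ge_0_finite)
    ultimately have "p ^ 2 \<le>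
        coin_avg (\<lambda>_. p) es' (\<lambda>H. if e \<inter> \<Union>(set (candidates es' H G)) = {} then 1 else 0)"
      using coin_avg_no_later_candidate[OF es' _ p, of e G] by simp
    then have "max 1 (real (card (e - U))) * p ^ 2 \<le> max 1 (real (card (e - U))) *
        coin_avg (\<lambda>_. p) es' (\<lambda>H. if e \<inter> \<Union>(set (candidates es' H G)) = {} then 1 else 0)"
      by (intro mult_left_mono) auto
    then show "?m U e \<le> coin_avg (\<lambda>_. p) es' (\<lambda>H.
        if e \<inter> \<Union>(set (candidates es' H G)) = {} then max 1 (real (card (e - U))) else 0)"
      by (simp add: coin_avg_cmult[symmetric] if_distrib[of "\<lambda>x. _ * x"] mult.commute cong: if_cong)
  qed (use p ranking(1) edge_props in auto)
  have mono: "coin_avg (\<lambda>_. p) rk (\<lambda>H. score s w {} (candidates rk H {})) \<le>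
      coin_avg (\<lambda>_. p) rk (\<lambda>H. score t w {} (candidates rk H {}))"
    if "\<And>U e X. s U e X \<le> t U e X" for s t
    using p that edge_props set_candidates_subset[of rk _ "{}"]
    by (intro coin_avg_mono score_mono) blast+
  have "p ^ 2 * ?C = coin_avg (\<lambda>_. p) rk (\<lambda>H. score (\<lambda>_ _ _. p ^ 2 * 1) w {} (candidates rk H {}))"
    unfolding score_cmult coin_avg_cmult ..
  also have "\<dots> \<le> coin_avg (\<lambda>_. p) rk (\<lambda>H. score (\<lambda>U e _. ?m U e) w {} (candidates rk H {}))"
    using p by (intro mono mult_left_mono) auto
  finally have 1: "p ^ 2 * ?C \<le> ?L" using L by linarith
  \<comment> \<open>The total weight bounds every single weight; its size costs nothing, as the
    potential starts at 0 with \<open>U\<close> empty.\<close>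
  define B where "B = (\<Sum>e\<in>E. w e)"
  have "finite E" using ranking(2) by (metis List.finite_set)
  then have ends: "card e = 2 \<and> 0 \<le> w e \<and> w e \<le> B" if "e \<in> set rk" for e
    unfolding B_def using that edge_props[OF that] weight_nonneg ranking(2)
    by (auto intro!: member_le_sum)
  have B: "0 \<le> B" unfolding B_def using weight_nonneg by (rule sum_nonneg)
  have "2 * p * ?C = coin_avg (\<lambda>_. p) rk (\<lambda>H. score (\<lambda>_ _ _. 2 * p * 1) w {} (candidates rk H {}))"
    unfolding score_cmult coin_avg_cmult ..
  also have "\<dots> \<le> coin_avg (\<lambda>_. p) rk (\<lambda>H. score (\<lambda>U e _. card (e - U)) w {} (candidates rk H {}))"
    using coin_avg_first_ends[OF ranking(1) ends ranking(3) finite.emptyI B p, of "{}"] by simp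
  finally have "p ^ 2 * (2 * p * ?C) \<le>
      p ^ 2 * coin_avg (\<lambda>_. p) rk (\<lambda>H. score (\<lambda>U e _. card (e - U)) w {} (candidates rk H {}))"
    by (rule mult_left_mono) simp
  also have "\<dots> = coin_avg (\<lambda>_. p) rk
      (\<lambda>H. score (\<lambda>U e _. p ^ 2 * real (card (e - U))) w {} (candidates rk H {}))"
    unfolding score_cmult coin_avg_cmult ..
  also have "\<dots> \<le> coin_avg (\<lambda>_. p) rk (\<lambda>H. score (\<lambda>U e _. ?m U e) w {} (candidates rk H {}))"
    by (intro mono mult_left_mono) auto
  finally have "2 * p ^ 3 * ?C \<le> ?L"
    using L by (simp add: power2_eq_square power3_eq_cube algebra_simps)
  then show ?thesis using 1 by (simp add: max_def)
qed

text \<open>By linearity over the two ends: each avoids all later candidates with probability at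
  least \<open>p\<close>.\<close>

lemma coin_avg_last_ends:
  assumes p: "0 \<le> p" "p \<le> 1"
  shows "2 * p * coin_avg (\<lambda>_. p) rk (\<lambda>H. score (\<lambda>_ _ _. 1) w {} (candidates rk H {})) \<le>
    coin_avg (\<lambda>_. p) rk (\<lambda>H. score (\<lambda>U e X. card (e - X)) w {} (candidates rk H {}))"
proof -
  have "coin_avg (\<lambda>_. p) rk (\<lambda>H. score (\<lambda>U e _. 2 * p) w {} (candidates rk H {})) \<le>
      coin_avg (\<lambda>_. p) rk (\<lambda>H. score (\<lambda>U e X. card (e - X)) w {} (candidates rk H {}))"
  proof (rule coin_avg_score_mono)
    fix es' :: "'v edge list" and e :: "'v edge" and G :: "'v edge set" and U :: "'v set"
    assume es': "distinct es'" and e: "e \<in> set rk" and free: "e \<inter> \<Union>G = {}"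
    have fin: "card e = 2" "finite e"
      using edge_props[OF e] by (auto intro: card_ge_0_finite)
    let ?f = "\<lambda>u H. if {u} \<inter> \<Union>(set (candidates es' H G)) = {} then 1 else 0 :: real"
    have "2 * p = (\<Sum>u\<in>e. p)" using fin by simp
    also have "\<dots> \<le> (\<Sum>u\<in>e. coin_avg (\<lambda>_. p) es' (?f u))"
    proof (rule sum_mono)
      fix u assume "u \<in> e"
      then have "{u} - \<Union>G = {u}" using free by auto
      then show "p \<le> coin_avg (\<lambda>_. p) es' (?f u)"
        using coin_avg_no_later_candidate[OF es' _ p, of "{u}" G] by simp
    qed
    also have "\<dots> = coin_avg (\<lambda>_. p) es' (\<lambda>H. \<Sum>u\<in>e. ?f u H)"
      by (rule coin_avg_sum[symmetric])
    also have "\<dots> = coin_avg (\<lambda>_. p) es' (\<lambda>H. real (card (e - \<Union>(set (candidates es' H G)))))"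
    proof (rule coin_avg_cong[OF refl])
      fix H
      let ?X = "\<Union>(set (candidates es' H G))"
      have "(\<Sum>u\<in>e. ?f u H) = (\<Sum>u\<in>e - ?X. 1)"
        using fin by (intro sum.mono_neutral_cong_right) auto
      then show "(\<Sum>u\<in>e. ?f u H) = real (card (e - ?X))" by simp
    qed
    finally show "2 * p \<le> coin_avg (\<lambda>_. p) es' (\<lambda>H. real (card (e - \<Union>(set (candidates es' H G)))))" .
  qed (use p ranking(1) edge_props in auto)
  moreover have "2 * p * coin_avg (\<lambda>_. p) rk (\<lambda>H. score (\<lambda>_ _ _. 1) w {} (candidates rk H {})) =
      coin_avg (\<lambda>_. p) rk (\<lambda>H. score (\<lambda>_ _ _. 2 * p * 1) w {} (candidates rk H {}))"
    unfolding score_cmult coin_avg_cmult ..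
  ultimately show ?thesis by simp
qed

text \<open>With C and A the expected weights of candidates and output, halving the bound for
  isolated edges gives the first two factors, and 2 p C \<le> C + A gives the third.\<close>

lemma coin_avg_greedy_based:
  assumes p: "0 \<le> p" "p \<le> 1" and arr: "arrival_strategy E arr"
  shows "max (max (p ^ 2 / 2) (p ^ 3)) (2 * p - 1) *
      coin_avg (\<lambda>_. p) rk (\<lambda>H. score (\<lambda>_ _ _. 1) w {} (candidates rk H {})) \<le>
    coin_avg (\<lambda>_. p) rk (\<lambda>H. sum w (greedy_based rk H (arr H)))"
    (is "_ * ?C \<le> ?A")
proof -
  have M: "maximal_matching w (candidates rk H {}) (greedy_based rk H (arr H))"
    if "H \<subseteq> set rk" for H
    using arr that ranking(2) by (intro maximal_matching_greedy_based) (auto simp: arrival_strategy_def)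
  have "coin_avg (\<lambda>_. p) rk (\<lambda>H.
      score (\<lambda>U e X. if e \<inter> X = {} then max 1 (real (card (e - U))) else 0) w {} (candidates rk H {})) \<le>
      coin_avg (\<lambda>_. p) rk (\<lambda>H. 2 * sum w (greedy_based rk H (arr H)))"
    using p by (intro coin_avg_mono maximal_matching.score_isolated_later M) auto
  then have "max (p ^ 2) (2 * p ^ 3) * ?C \<le> 2 * ?A"
    using coin_avg_isolated_later[OF p] by (simp add: coin_avg_cmult)
  then have "max (p ^ 2 / 2) (p ^ 3) * ?C \<le> ?A"
    by (simp add: max_def split: if_splits)
  moreover have "(2 * p - 1) * ?C \<le> ?A"
  proof -
    have d: "distinct (candidates rk H {})" for H
      using ranking(1) by (rule distinct_candidates)
    have "coin_avg (\<lambda>_. p) rk (\<lambda>H. score (\<lambda>U e X. card (e - X)) w {} (candidates rk H {})) \<le>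
        coin_avg (\<lambda>_. p) rk (\<lambda>H. sum w (set (candidates rk H {})) + sum w (greedy_based rk H (arr H)))"
      using p by (intro coin_avg_mono maximal_matching.score_last_ends M d) auto
    also have "\<dots> = ?C + ?A" by (simp add: coin_avg_add score_one[OF d])
    finally show ?thesis using coin_avg_last_ends[OF p] by (simp add: algebra_simps)
  qed
  ultimately show ?thesis by (auto simp: max_def)
qed

lemma max_weight_nonneg:
  assumes "F \<subseteq> E"
  shows "0 \<le> max_weight w F"
proof -
  have "finite F" using assms ranking(2) finite_subset by blast
  then obtain M where "M \<subseteq> F" "max_weight w F = sum w M" by (rule ex_max_weight)
  then show ?thesis using assms weight_nonneg by (auto intro!: sum_nonneg)
qed

lemma coin_avg_max_weight_greedy:
  assumes p: "0 < p" "p < 1"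
  shows "min (1 / 2) (p / (1 - p)) * coin_avg (\<lambda>_. p) rk (\<lambda>H. max_weight w (E - H)) \<le>
    coin_avg (\<lambda>_. p) rk (\<lambda>H. sum w (greedy rk H))"
proof -
  \<comment> \<open>Above 1/2 the factor \<open>min 1 (2 * r)\<close> stops growing, and
    \<open>p / (1 - p)\<close> is the largest \<open>r\<close> compatible with marginal
    \<open>p\<close>. Then \<open>s\<close> solves the marginal equation and is nonnegative.\<close>
  define r where "r = min (1 / 2) (p / (1 - p))"
  define s where "s = (p - (1 - p) * r) / p"
  have "0 \<le> r" using p by (simp add: r_def)
  have "r \<le> 1 / 2" unfolding r_def by (rule min.cobounded1)
  note r = \<open>0 \<le> r\<close> this
  have "(1 - p) * r \<le> (1 - p) * (p / (1 - p))"
    using p by (intro mult_left_mono) (auto simp: r_def)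
  then have "0 \<le> s" "s \<le> 1" using p r by (auto simp: s_def)
  moreover have "(1 - p) * r + p * s = p" using p by (simp add: s_def)
  ultimately have "min 1 (2 * r) * coin_avg (\<lambda>_. p) rk (\<lambda>H. max_weight w (set rk - H)) \<le>
      2 * coin_avg (\<lambda>_. p) rk (\<lambda>H. sum w (greedy rk H))"
    using p r ranking(1,3) edge_props by (intro coin_avg_greedy_max_weight[of _ _ _ _ s]) auto
  moreover have "min 1 (2 * r) = 2 * r" using r by (simp add: min_def)
  ultimately show ?thesis using ranking(2) unfolding r_def[symmetric] by simp
qed

end

section \<open>The four ranges of the ratio\<close>

text \<open>Each branch picks one term of the minimum and one of the maximum. The terms cross at the
  breakpoints: \<open>p / (1 - p)\<close> is 1/2 at 1/3, \<open>p ^ 2 / 2\<close> equals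
  \<open>p ^ 3\<close> at 1/2, and \<open>p ^ 3\<close> equals \<open>2 * p - 1\<close> at the root
  of p^2 + p = 1.\<close>

lemma ratio_le:
  assumes "0 < p" "p < 1"
  shows "ratio p \<le>
    min (1 / 2) (p / (1 - p)) * ((1 - p) / p) * max (max (p ^ 2 / 2) (p ^ 3)) (2 * p - 1)"
    (is "_ \<le> _ * ?m")
proof (cases "p \<le> 1 / 3")
  case True
  then have "min (1 / 2) (p / (1 - p)) * ((1 - p) / p) = 1"
    using assms by (simp add: min_def field_simps)
  moreover have "p ^ 2 / 2 \<le> ?m" by (simp only: le_max_iff_disj order_refl simp_thms)
  ultimately show ?thesis using True by (simp only: ratio_def if_True mult_1)
next
  case False
  then have "min (1 / 2) (p / (1 - p)) = 1 / 2"
    using assms by (simp add: min_def field_simps)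
  then have eq: "min (1 / 2) (p / (1 - p)) * ((1 - p) / p) = (1 - p) / (2 * p)"
    by (simp only:)
  let ?t = "if p \<le> 1 / 2 then p ^ 2 / 2 else if p \<le> (sqrt 5 - 1) / 2 then p ^ 3 else 2 * p - 1"
  have "p * (1 - p) / 4 = (1 - p) / (2 * p) * (p ^ 2 / 2)"
    "p ^ 2 * (1 - p) / 2 = (1 - p) / (2 * p) * p ^ 3"
    using assms by (simp_all add: power2_eq_square power3_eq_cube)
  then have "ratio p = (1 - p) / (2 * p) * ?t"
    using False unfolding ratio_def by simp
  also have "\<dots> \<le> (1 - p) / (2 * p) * ?m"
  proof (rule mult_left_mono)
    show "?t \<le> ?m"
      by (simp only: le_max_iff_disj order_refl simp_thms split: if_split)
  qed (use assms in simp)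
  finally show ?thesis unfolding eq .
qed

theorem theorem5p10:
  fixes p :: real
  assumes "0 \<le> p" and "p \<le> 1 / sqrt 2"
  shows "competitive_AOSp p (ratio p)
           ((\<lambda>w rk H arrivals. greedy_based rk H arrivals) :: 'v algorithm)"
  unfolding competitive_AOSp_def
proof (intro allI impI)
  fix V :: "'v set" and E w rk arr
  assume graph: "weighted_graph V E w rk" and arr: "arrival_strategy E arr"
  interpret weighted_graph V E w rk by fact
  let ?opt = "coin_avg (\<lambda>_. p) rk (\<lambda>H. max_weight w (E - H))"
  let ?alg = "coin_avg (\<lambda>_. p) rk (\<lambda>H. sum w (greedy_based rk H (arr H)))"
  let ?G = "coin_avg (\<lambda>_. p) rk (\<lambda>H. sum w (greedy rk H))"
  let ?C = "coin_avg (\<lambda>_. p) rk (\<lambda>H. score (\<lambda>_ _ _. 1) w {} (candidates rk H {}))"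
  let ?m = "max (max (p ^ 2 / 2) (p ^ 3)) (2 * p - 1)"
  let ?r = "min (1 / 2) (p / (1 - p))"
  have "1 / sqrt 2 < 1" by simp
  then have p: "p < 1" using assms(2) by linarith
  have "ratio p * ?opt \<le> ?alg"
  \<comment> \<open>The chain of estimates divides by \<open>p\<close>. At 0 the ratio vanishes, so
    a nonnegative output suffices.\<close>
  proof (cases "p = 0")
    case True
    have "coin_avg (\<lambda>_. p) rk (\<lambda>_. 0) \<le> ?alg"
    proof (rule coin_avg_mono)
      fix H assume "H \<subseteq> set rk"
      then interpret maximal_matching w "candidates rk H {}" "greedy_based rk H (arr H)"
        using arr ranking(2)
        by (intro maximal_matching_greedy_based) (auto simp: arrival_strategy_def)
      show "0 \<le> sum w (greedy_based rk H (arr H))" by (intro sum_nonneg weight_nonneg)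
    qed (use True in simp)
    then show ?thesis using True by (simp add: ratio_def)
  next
    case False
    then have pos: "0 < p" using assms(1) by simp
    have "coin_avg (\<lambda>_. p) rk (\<lambda>_. 0) \<le> ?opt"
      using pos p by (intro coin_avg_mono max_weight_nonneg) auto
    then have "ratio p * ?opt \<le> ?r * ((1 - p) / p) * ?m * ?opt"
      using ratio_le[OF pos p] by (intro mult_right_mono) simp_all
    \<comment> \<open>Regrouped so as to pass from the optimum to the greedy matching, then to the
      candidates, then to the output.\<close>
    also have "\<dots> = ?m * ((1 - p) / p * (?r * ?opt))" by (simp only: ac_simps)
    also have "\<dots> \<le> ?m * ((1 - p) / p * ?G)"
      using coin_avg_max_weight_greedy[OF pos p] pos p
      by (intro mult_left_mono) (auto simp: le_max_iff_disj)
    also have "(1 - p) / p * ?G = ?C"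
    proof -
      have "{} \<notin> set rk" using edge_props by fastforce
      then have "p * ?C = (1 - p) * ?G"
        using coin_avg_candidates_greedy[OF ranking(1), of "{}" p w "{}"] by (simp add: greedy_def)
      then show ?thesis using pos by (simp add: field_simps)
    qed
    also have "?m * ?C \<le> ?alg"
      using coin_avg_greedy_based[OF _ _ arr] pos p by simp
    finally show ?thesis .
  qed
  then show "ratio p * measure_pmf.expectation (history_pmf p E) (\<lambda>H. max_weight w (E - H)) \<le>
      measure_pmf.expectation (history_pmf p E) (\<lambda>H. sum w (greedy_based rk H (arr H)))"
    using expectation_history_pmf[OF ranking(1), of p] assms(1) p ranking(2) by simp
qed

end
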